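(* For any integers $a,b,r\ge 0$, $$G_{a,b}^{\ge r,0}(q)=\begin{cases} q^{\binom{r+1}{2}}\begin{bmatrix}a+b\\ a+r\end{bmatrix}_q & \text{if } a>b,\\[2mm] (1+q^a)\,q^{\binom{r+1}{2}}\begin{bmatrix}2a-1\\ a+r\end{bmatrix}_q & \text{if } a=b,\\[2mm] q^{\binom{r}{2}}\begin{bmatrix}a+b\\ a-r\end{bmatrix}_q & \text{if } a<b.\end{cases}$$
   Context: For integers $a,b\ge0$, $\mathcal G_{a,b}$ denotes the set of lattice paths in $\mathbb Z^2$ starting at the origin and consisting of $a$ steps $U=(1,1)$ and $b$ steps $D=(1,-1)$ (in any order). A valley of a path is a vertex preceded by a $D$ and followed by a $U$; the major index $\operatorname{maj}(P)$ is the sum of the $x$-coordinates of the valleys of $P$. For $\ell\in\mathbb Z$, a crossing of $P$ with the line $y=\ell$ is a vertex of $P$ on this line that is either preceded and followed by a $D$, or preceded and followed by a $U$. For an integer $r\ge0$, $\mathcal G_{a,b}^{\ge r,\ell}$ is the set of paths in $\mathcal G_{a,b}$ that cross the line $y=\ell$ at least $r$ times, and $$G_{a,b}^{\ge r,\ell}(q)=\sum_{P\in\mathcal G_{a,b}^{\ge r,\ell}}q^{\operatorname{maj}(P)}.$$ The $q$-binomial coefficient is $$\begin{bmatrix}n\\k\end{bmatrix}_q=\frac{(1-q^n)(1-q^{n-1})\cdots(1-q^{n-k+1})}{(1-q^k)(1-q^{k-1})\cdots(1-q)}$$ if $0\le k\le n$, and $0$ otherwise.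
   Formalization: The case a = b = r = 0 is excluded, because there the left side is 1 (the empty path) while the right side is 2·[-1 choose 0]_q = 0 under the stated convention. *)

theory Defs
  imports "HOL-Computational_Algebra.Computational_Algebra" "HOL-Library.Product_Plus"
begin

(* A lattice path starting at the origin is given by its list of steps. *)

datatype step = U | D

fun step_vec :: "step \<Rightarrow> int \<times> int" where
  "step_vec U = (1, 1)"
| "step_vec D = (1, -1)"

(* The vertices of P are vertex P 0, ..., vertex P (length P); for 0 < i < length P,
   vertex P i is preceded by the step P ! (i - 1) and followed by the step P ! i. *)

definition vertex :: "step list \<Rightarrow> nat \<Rightarrow> int \<times> int" where
  "vertex P i = sum_list (map step_vec (take i P))"

definition lattice_paths :: "nat \<Rightarrow> nat \<Rightarrow> step list set" where
  "lattice_paths a b = {P. count_list P U = a \<and> count_list P D = b}"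

definition valleys :: "step list \<Rightarrow> nat set" where
  "valleys P = {i. 0 < i \<and> i < length P \<and> P ! (i - 1) = D \<and> P ! i = U}"

(* The x-coordinate of a vertex is never negative (see fst_vertex), so nat loses nothing. *)

definition maj :: "step list \<Rightarrow> nat" where
  "maj P = (\<Sum>i\<in>valleys P. nat (fst (vertex P i)))"

definition crossings :: "int \<Rightarrow> step list \<Rightarrow> nat set" where
  "crossings l P = {i. 0 < i \<and> i < length P \<and> snd (vertex P i) = l \<and>
     (P ! (i - 1) = D \<and> P ! i = D \<or> P ! (i - 1) = U \<and> P ! i = U)}"

definition crossing_paths :: "nat \<Rightarrow> nat \<Rightarrow> nat \<Rightarrow> int \<Rightarrow> step list set" where
  "crossing_paths a b r l = {P \<in> lattice_paths a b. card (crossings l P) \<ge> r}"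

(* The generating function, as a polynomial in the indeterminate q. *)

definition crossing_gf :: "nat \<Rightarrow> nat \<Rightarrow> nat \<Rightarrow> int \<Rightarrow> int poly" where
  "crossing_gf a b r l = (\<Sum>P\<in>crossing_paths a b r l. monom 1 (maj P))"

(* The q-binomial coefficient is a quotient of polynomials in q, so it is formed in the field
   of fractions of Z[q], where every 1 - q^i with i > 0 is nonzero.  The arguments are integers
   so that the coefficient vanishes for a negative lower argument. *)

definition qvar :: "int poly fract" where
  "qvar = to_fract (monom 1 1)"

definition qbinomial :: "int \<Rightarrow> int \<Rightarrow> int poly fract" where
  "qbinomial n k =
     (if 0 \<le> k \<and> k \<le> n
      then (\<Prod>i=n-k+1..n. 1 - qvar ^ nat i) / (\<Prod>i=1..k. 1 - qvar ^ nat i)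
      else 0)"

lemma fst_vertex:
  assumes "i \<le> length P"
  shows "fst (vertex P i) = int i"
proof -
  have *: "fst (sum_list (map step_vec xs)) = int (length xs)" for xs
  proof (induction xs)
    case (Cons s xs)
    then show ?case by (cases s) auto
  qed simp
  show ?thesis using assms by (simp add: vertex_def *)
qed

lemma finite_lattice_paths: "finite (lattice_paths a b)"
proof (rule finite_subset)
  have "length P = count_list P U + count_list P D" for P
  proof (induction P)
    case (Cons s P)
    then show ?case by (cases s) auto
  qed simp
  then show "lattice_paths a b \<subseteq> {P. set P \<subseteq> {U, D} \<and> length P = a + b}"
    by (auto simp: lattice_paths_def intro: step.exhaust)
  show "finite {P. set P \<subseteq> {U, D} \<and> length P = a + b}"
    by (rule finite_lists_length_eq) simp
qed

lemma finite_valleys: "finite (valleys P)"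
  by (simp add: valleys_def)

lemma finite_crossings: "finite (crossings l P)"
  by (simp add: crossings_def)

(* For a = b = r = 0 the only path is the empty one, which has generating function 1, whereas
   the product (1 + q^a) * q^(r+1 choose 2) * [2a-1, a+r] has the factor [-1, 0] = 0. *)

lemma crossing_gf_0_0_0: "crossing_gf 0 0 0 l = 1"
proof -
  have "crossing_paths 0 0 0 l = {[]}"
  proof -
    have "P = []" if "count_list P U = 0" "count_list P D = 0" for P
      using that
    proof (cases P)
      case (Cons s Q)
      then show ?thesis using that by (cases s) auto
    qed
    then show ?thesis by (auto simp: crossing_paths_def lattice_paths_def)
  qed
  then show ?thesis by (simp add: crossing_gf_def maj_def valleys_def)
qed

lemma qbinomial_minus_1_0: "qbinomial (-1) 0 = 0"
  by (simp add: qbinomial_def)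

end

theory Submission
  imports Defs
begin

text \<open>
  Split the nonempty paths according to their last step, and let \<open>ending_gf s a b r\<close> count those
  that end with \<open>s\<close> and cross the axis at least \<open>r\<close> times.  Appending a step to a path creates
  at most one valley and at most one crossing, both at the old endpoint, and whether it does so
  depends only on the old last step and, for the crossing, on whether the old endpoint \<open>(a, b)\<close>
  is on the axis, that is, on whether \<open>a = b\<close>.  So these generating functions satisfy a linear
  recursion in \<open>(a, b)\<close> (\<open>ending_gf_U_rec\<close>, \<open>ending_gf_D_rec\<close>), and each of them
  is a single \<open>q\<close>-binomial coefficient times a power of \<open>q\<close> (\<open>ending_gf_closed\<close>).

  Off the axis, the recursion for these products is one of the two \<open>q\<close>-Pascal rules.  The
  products have one form below the axis and another one above it.  The change of form happens on
  the axis, where the recursion replaces \<open>r\<close> by \<open>r - 1\<close>: since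
  \<open>(r choose 2) = ((r - 1) choose 2) + (r - 1)\<close>, the form with \<open>r - 1\<close> on one side of the axis
  turns, by the symmetry of the \<open>q\<close>-binomial coefficient, into the form with \<open>r\<close> on the other
  side.  For \<open>r = 0\<close> the two forms already agree there.  Adding the two closed forms, by a
  \<open>q\<close>-Pascal rule once more, gives the theorem.
\<close>

section \<open>Pascal rules for q-binomial coefficients\<close>

lemma qvar_nonzero: "qvar \<noteq> 0"
  by (simp add: qvar_def)

lemma to_fract_power: "to_fract (x ^ n) = to_fract x ^ n"
  by (induction n) simp_all

lemma qvar_power: "qvar ^ n = to_fract (monom 1 n)"
  by (simp add: qvar_def monom_power flip: to_fract_power)

lemma one_minus_qvar_power_nonzero:
  assumes "n > 0"
  shows "1 - qvar ^ n \<noteq> 0"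
proof
  assume "1 - qvar ^ n = 0"
  then have "to_fract (monom 1 n) = to_fract (1 :: int poly)"
    by (simp add: qvar_power)
  then have "monom 1 n = (1 :: int poly)"
    by (simp only: to_fract_eq_iff)
  then show False
    using assms by (metis degree_1 degree_monom_eq less_numeral_extra(3) zero_neq_one)
qed

definition qfact :: "int \<Rightarrow> int poly fract" where
  "qfact n = (\<Prod>i=1..n. 1 - qvar ^ nat i)"

lemma qfact_nonzero: "qfact n \<noteq> 0"
  using one_minus_qvar_power_nonzero[of "nat _"] by (simp add: qfact_def del: right_minus_eq)

lemma qfact_rec:
  assumes "n \<ge> 1"
  shows "qfact n = (1 - qvar powi n) * qfact (n - 1)"
proof -
  have "{1..n} = insert n {1..n - 1}"
    using assms by auto
  then show ?thesis
    using assms by (simp add: qfact_def power_int_def)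
qed

lemma qbinomial_qfact:
  assumes "0 \<le> k" "k \<le> n"
  shows "qbinomial n k = qfact n / (qfact k * qfact (n - k))"
proof -
  have "{1..n} = {1..n - k} \<union> {n - k + 1..n}"
    using assms by auto
  moreover have "{1..n - k} \<inter> {n - k + 1..n} = {}"
    by auto
  ultimately have "qfact n = qfact (n - k) * (\<Prod>i=n - k + 1..n. 1 - qvar ^ nat i)"
    by (simp add: qfact_def prod.union_disjoint)
  then show ?thesis
    using assms qfact_nonzero[of "n - k"] by (simp add: qbinomial_def qfact_def[of k])
qed

lemma qbinomial_sym: "qbinomial n (n - k) = qbinomial n k"
proof (cases "0 \<le> k \<and> k \<le> n")
  case True
  then show ?thesis
    by (simp add: qbinomial_qfact mult.commute)
qed (auto simp: qbinomial_def)

lemma qbinomial_0: "n \<ge> 0 \<Longrightarrow> qbinomial n 0 = 1"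
  by (simp add: qbinomial_def)

lemma qbinomial_self: "n \<ge> 0 \<Longrightarrow> qbinomial n n = 1"
  using qbinomial_sym[of n n] by (simp add: qbinomial_0)

text \<open>
  In the range \<open>0 < k < n\<close> this is the identity \<open>1 - q^n = (1 - q^k) + q^k (1 - q^(n-k))\<close>
  times a common factor.  An integer exponent makes the rule valid for every \<open>k\<close>.
\<close>

lemma qbinomial_pascal:
  assumes "n \<ge> 1"
  shows "qbinomial n k = qbinomial (n - 1) (k - 1) + qvar powi k * qbinomial (n - 1) k"
proof -
  consider "k < 0 \<or> k > n" | "k = 0" | "k = n" | "0 < k" "k < n"
    by linarith
  then show ?thesis
  proof cases
    case 1
    then show ?thesis
      by (auto simp: qbinomial_def)
  next
    case 2
    then show ?thesis
      using assms by (simp add: qbinomial_0) (simp add: qbinomial_def)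
  next
    case 3
    then show ?thesis
      using assms by (simp add: qbinomial_self) (simp add: qbinomial_def)
  next
    case 4
    define c where "c = qfact (n - 1) / (qfact k * qfact (n - k))"
    have "qbinomial n k = (1 - qvar powi n) * c"
      using 4 by (simp add: qbinomial_qfact qfact_rec[of n] c_def)
    moreover have "qbinomial (n - 1) (k - 1) = (1 - qvar powi k) * c"
    proof -
      have "1 - qvar powi k \<noteq> 0"
        using 4 one_minus_qvar_power_nonzero[of "nat k"] by (simp add: power_int_def)
      then show ?thesis
        using 4 by (simp add: qbinomial_qfact qfact_rec[of k] c_def)
    qed
    moreover have "qbinomial (n - 1) k = (1 - qvar powi (n - k)) * c"
    proof -
      have "1 - qvar powi (n - k) \<noteq> 0"
        using 4 one_minus_qvar_power_nonzero[of "nat (n - k)"] by (simp add: power_int_def)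
      then show ?thesis
        using 4 by (simp add: qbinomial_qfact qfact_rec[of "n - k"] c_def diff_diff_add add.commute)
    qed
    moreover have "qvar powi n = qvar powi k * qvar powi (n - k)"
      by (simp add: qvar_nonzero flip: power_int_add)
    ultimately show ?thesis
      by (simp only:) (simp add: algebra_simps)
  qed
qed

lemma qbinomial_pascal':
  assumes "n \<ge> 1"
  shows "qbinomial n k = qbinomial (n - 1) k + qvar powi (n - k) * qbinomial (n - 1) (k - 1)"
  using qbinomial_pascal[OF assms, of "n - k"] qbinomial_sym[of n k]
    qbinomial_sym[of "n - 1" k] qbinomial_sym[of "n - 1" "k - 1"]
  by (simp add: algebra_simps)

section \<open>Appending a step to a path\<close>

lemma vertex_append: "i \<le> length P \<Longrightarrow> vertex (P @ Q) i = vertex P i"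
  by (simp add: vertex_def)

lemma vertex_length: "snd (vertex P (length P)) = int (count_list P U) - int (count_list P D)"
proof (induction P)
  case (Cons s P)
  then show ?case
    by (cases s) (auto simp: vertex_def)
qed (simp add: vertex_def)

lemma maj_snoc:
  "maj (P @ [s]) = maj P + (if P \<noteq> [] \<and> last P = D \<and> s = U then length P else 0)"
proof -
  let ?new = "if P \<noteq> [] \<and> last P = D \<and> s = U then {length P} else {}"
  have valleys: "valleys (P @ [s]) = valleys P \<union> ?new"
    by (cases "P = []") (auto simp: valleys_def nth_append last_conv_nth less_Suc_eq)
  have disj: "valleys P \<inter> ?new = {}"
    by (auto simp: valleys_def)
  have "nat (fst (vertex (P @ [t]) i)) = i" if "i \<le> length P" for i t
    using that by (simp add: fst_vertex)
  moreover have "nat (fst (vertex P i)) = i" if "i \<in> valleys P" for i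
    using that by (simp add: fst_vertex valleys_def)
  moreover have "i \<le> length P" if "i \<in> valleys P" for i
    using that by (simp add: valleys_def)
  ultimately show ?thesis
    by (simp add: maj_def valleys sum.union_disjoint[OF finite_valleys _ disj])
qed

lemma card_crossings_snoc:
  "card (crossings 0 (P @ [s])) = card (crossings 0 P) +
     (if P \<noteq> [] \<and> last P = s \<and> count_list P U = count_list P D then 1 else 0)"
proof -
  let ?new = "if P \<noteq> [] \<and> last P = s \<and> count_list P U = count_list P D then {length P} else {}"
  have "i \<in> crossings 0 (P @ [s]) \<longleftrightarrow> i \<in> crossings 0 P \<union> ?new" for i
  proof (cases "P \<noteq> [] \<and> i = length P")
    case True
    then have "(P @ [s]) ! (i - 1) = last P" "(P @ [s]) ! i = s"
      by (simp_all add: nth_append last_conv_nth)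
    then show ?thesis
      using True vertex_length[of P]
      by (cases s) (auto simp: crossings_def vertex_append)
  next
    case False
    then show ?thesis
      by (auto simp: crossings_def nth_append vertex_append less_Suc_eq)
  qed
  then have "crossings 0 (P @ [s]) = crossings 0 P \<union> ?new"
    by blast
  moreover have "crossings 0 P \<inter> ?new = {}"
    by (auto simp: crossings_def)
  ultimately show ?thesis
    by (simp add: card_Un_disjoint finite_crossings)
qed

lemma length_lattice_path: "P \<in> lattice_paths a b \<Longrightarrow> length P = a + b"
proof -
  have "length P = count_list P U + count_list P D"
  proof (induction P)
    case (Cons s P)
    then show ?case
      by (cases s) auto
  qed simp
  then show "P \<in> lattice_paths a b \<Longrightarrow> length P = a + b"
    by (simp add: lattice_paths_def)
qed

section \<open>Paths with a prescribed last step\<close>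

definition ending_paths :: "step \<Rightarrow> nat \<Rightarrow> nat \<Rightarrow> nat \<Rightarrow> step list set" where
  "ending_paths s a b r = {P \<in> crossing_paths a b r 0. P \<noteq> [] \<and> last P = s}"

definition ending_gf :: "step \<Rightarrow> nat \<Rightarrow> nat \<Rightarrow> nat \<Rightarrow> int poly fract" where
  "ending_gf s a b r = (\<Sum>P\<in>ending_paths s a b r. qvar ^ maj P)"

lemma finite_crossing_paths: "finite (crossing_paths a b r l)"
  unfolding crossing_paths_def using finite_lattice_paths by simp

lemma finite_ending_paths: "finite (ending_paths s a b r)"
  unfolding ending_paths_def using finite_crossing_paths by simp

lemma ending_paths_disjoint: "ending_paths U a b r \<inter> ending_paths D a b r' = {}"
  by (auto simp: ending_paths_def)

lemma crossing_paths_eq_ending_paths: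
  assumes "a + b > 0"
  shows "crossing_paths a b r 0 = ending_paths U a b r \<union> ending_paths D a b r"
proof -
  have "P \<noteq> []" if "P \<in> crossing_paths a b r 0" for P
    using that assms by (auto simp: crossing_paths_def lattice_paths_def)
  moreover have "last P = U \<or> last P = D" for P
    by (cases "last P") auto
  ultimately show ?thesis
    unfolding ending_paths_def by blast
qed

lemma to_fract_crossing_gf:
  assumes "a + b > 0"
  shows "to_fract (crossing_gf a b r 0) = ending_gf U a b r + ending_gf D a b r"
  unfolding crossing_gf_def to_fract_sum ending_gf_def crossing_paths_eq_ending_paths[OF assms]
  by (simp add: sum.union_disjoint finite_ending_paths ending_paths_disjoint qvar_power)

text \<open>
  Truncated subtraction in \<open>r - 1\<close> is what is wanted: asking for at least \<open>0\<close> crossings is no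
  condition, before as well as after the new crossing.
\<close>

lemma ending_paths_U_Suc:
  assumes "a + b > 0"
  shows "ending_paths U (Suc a) b r = (\<lambda>P. P @ [U]) `
    (ending_paths U a b (if a = b then r - 1 else r) \<union> ending_paths D a b r)"
  (is "?L = ?f ` ?R")
proof -
  have "P @ [U] \<in> ?L \<longleftrightarrow> P \<in> ?R" for P
    using assms
    by (cases "P = []"; cases "last P")
      (auto simp: ending_paths_def crossing_paths_def lattice_paths_def card_crossings_snoc)
  moreover have "P \<in> range ?f" if "P \<in> ?L" for P
    using that append_butlast_last_id[of P] by (auto simp: ending_paths_def intro!: range_eqI[of _ _ "butlast P"])
  ultimately show ?thesis
    by blast
qed

lemma ending_paths_D_Suc:
  assumes "a + b > 0"
  shows "ending_paths D a (Suc b) r = (\<lambda>P. P @ [D]) `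
    (ending_paths U a b r \<union> ending_paths D a b (if a = b then r - 1 else r))"
  (is "?L = ?f ` ?R")
proof -
  have "P @ [D] \<in> ?L \<longleftrightarrow> P \<in> ?R" for P
    using assms
    by (cases "P = []"; cases "last P")
      (auto simp: ending_paths_def crossing_paths_def lattice_paths_def card_crossings_snoc)
  moreover have "P \<in> range ?f" if "P \<in> ?L" for P
    using that append_butlast_last_id[of P] by (auto simp: ending_paths_def intro!: range_eqI[of _ _ "butlast P"])
  ultimately show ?thesis
    by blast
qed

lemma inj_on_snoc: "inj_on (\<lambda>P. P @ [s]) A"
  by (simp add: inj_on_def)

lemma ending_gf_U_rec:
  assumes "a + b > 0"
  shows "ending_gf U (Suc a) b r =
    ending_gf U a b (if a = b then r - 1 else r) + qvar ^ (a + b) * ending_gf D a b r"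
proof -
  have "(\<Sum>P\<in>ending_paths U a b r'. qvar ^ maj (P @ [U])) = ending_gf U a b r'" for r'
    unfolding ending_gf_def by (rule sum.cong) (auto simp: ending_paths_def maj_snoc)
  moreover have "(\<Sum>P\<in>ending_paths D a b r. qvar ^ maj (P @ [U])) =
      qvar ^ (a + b) * ending_gf D a b r"
    unfolding ending_gf_def sum_distrib_left
    by (rule sum.cong) (auto simp: ending_paths_def maj_snoc crossing_paths_def
        length_lattice_path power_add)
  ultimately show ?thesis
    unfolding ending_gf_def[of U "Suc a"] ending_paths_U_Suc[OF assms]
    by (simp add: sum.reindex inj_on_snoc sum.union_disjoint finite_ending_paths
        ending_paths_disjoint)
qed

lemma ending_gf_D_rec:
  assumes "a + b > 0"
  shows "ending_gf D a (Suc b) r =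
    ending_gf U a b r + ending_gf D a b (if a = b then r - 1 else r)"
proof -
  have "(\<Sum>P\<in>ending_paths s a b r'. qvar ^ maj (P @ [D])) = ending_gf s a b r'" for s r'
    unfolding ending_gf_def by (rule sum.cong) (auto simp: ending_paths_def maj_snoc)
  then show ?thesis
    unfolding ending_gf_def[of D _ "Suc b"] ending_paths_D_Suc[OF assms]
    by (simp add: sum.reindex inj_on_snoc sum.union_disjoint finite_ending_paths
        ending_paths_disjoint)
qed

lemma ending_paths_no_step: "ending_paths U 0 b r = {}" "ending_paths D a 0 r = {}"
proof -
  have "count_list P s \<noteq> 0" if "P \<noteq> []" "last P = s" for P and s :: step
    using that last_in_set[of P] by (simp add: count_list_0_iff)
  then show "ending_paths U 0 b r = {}" "ending_paths D a 0 r = {}"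
    unfolding ending_paths_def crossing_paths_def lattice_paths_def by blast+
qed

lemma ending_gf_no_step: "ending_gf U 0 b r = 0" "ending_gf D a 0 r = 0"
  by (simp_all add: ending_gf_def ending_paths_no_step)

lemma ending_gf_single_step:
  "ending_gf U 1 0 r = (if r = 0 then 1 else 0)"
  "ending_gf D 0 1 r = (if r = 0 then 1 else 0)"
proof -
  have single: "P = [U] \<or> P = [D]" if len: "length P = 1" for P
  proof -
    obtain s where "P = [s]"
      using len by (cases P) auto
    then show ?thesis
      by (cases s) simp_all
  qed
  have no_crossing: "crossings 0 [s] = {}" for s
    by (auto simp: crossings_def)
  have maj: "maj [s] = 0" for s
    by (simp add: maj_def valleys_def)
  have "P \<in> lattice_paths 1 0 \<longleftrightarrow> P = [U]" for P
  proof
    assume P: "P \<in> lattice_paths 1 0"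
    then have "length P = 1"
      using length_lattice_path by fastforce
    then have "P = [U] \<or> P = [D]"
      by (rule single)
    moreover have "P \<noteq> [D]"
      using P by (auto simp: lattice_paths_def)
    ultimately show "P = [U]"
      by blast
  qed (simp add: lattice_paths_def)
  then have "lattice_paths 1 0 = {[U]}"
    by blast
  then have "ending_paths U 1 0 r = {P \<in> {[U]}. r \<le> card (crossings 0 P)}"
    unfolding ending_paths_def crossing_paths_def by (simp only:) fastforce
  also have "\<dots> = (if r = 0 then {[U]} else {})"
    by (cases "r = 0") (simp_all add: no_crossing Collect_conv_if)
  finally have "ending_paths U 1 0 r = (if r = 0 then {[U]} else {})" .
  then show "ending_gf U 1 0 r = (if r = 0 then 1 else 0)"
    by (simp add: ending_gf_def maj)
  have "P \<in> lattice_paths 0 1 \<longleftrightarrow> P = [D]" for P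
  proof
    assume P: "P \<in> lattice_paths 0 1"
    then have "length P = 1"
      using length_lattice_path by fastforce
    then have "P = [U] \<or> P = [D]"
      by (rule single)
    moreover have "P \<noteq> [U]"
      using P by (auto simp: lattice_paths_def)
    ultimately show "P = [D]"
      by blast
  qed (simp add: lattice_paths_def)
  then have "lattice_paths 0 1 = {[D]}"
    by blast
  then have "ending_paths D 0 1 r = {P \<in> {[D]}. r \<le> card (crossings 0 P)}"
    unfolding ending_paths_def crossing_paths_def by (simp only:) fastforce
  also have "\<dots> = (if r = 0 then {[D]} else {})"
    by (cases "r = 0") (simp_all add: no_crossing Collect_conv_if)
  finally have "ending_paths D 0 1 r = (if r = 0 then {[D]} else {})" .
  then show "ending_gf D 0 1 r = (if r = 0 then 1 else 0)"
    by (simp add: ending_gf_def maj)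
qed

section \<open>Closed forms\<close>

text \<open>
  A path whose endpoint is on the axis arrives there from the side its last step comes from, so
  the case \<open>a = b\<close> is grouped with the paths below the axis for the last step \<open>U\<close> and with those
  above it for the last step \<open>D\<close>.
\<close>

definition closed_U :: "nat \<Rightarrow> nat \<Rightarrow> nat \<Rightarrow> int poly fract" where
  "closed_U a b r =
    (if a > b
     then qvar ^ ((r choose 2) + b) * qbinomial (int a + int b - 1) (int a + int r - 1)
     else qvar ^ ((r choose 2) + b + r) * qbinomial (int a + int b - 1) (int a - int r - 1))"

definition closed_D :: "nat \<Rightarrow> nat \<Rightarrow> nat \<Rightarrow> int poly fract" where
  "closed_D a b r =
    (if a \<ge> b
     then qvar ^ ((r choose 2) + r) * qbinomial (int a + int b - 1) (int a + int r)
     else qvar ^ (r choose 2) * qbinomial (int a + int b - 1) (int a - int r))"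

lemma choose_2_Suc: "Suc r choose 2 = (r choose 2) + r"
  by (simp add: numeral_2_eq_2)

text \<open>
  On the axis, the form valid for \<open>a \<le> b\<close>, taken at \<open>r - 1\<close>, is the form for \<open>a > b\<close>
  at \<open>r\<close>.  This is where crossings enter.
\<close>

lemma closed_U_axis:
  "closed_U a a (r - 1) = qvar ^ ((r choose 2) + a) * qbinomial (2 * int a - 1) (int a + int r - 1)"
proof (cases r)
  case 0
  then show ?thesis
    by (simp add: closed_U_def numeral_2_eq_2)
next
  case (Suc k)
  then show ?thesis
    using qbinomial_sym[of "2 * int a - 1" "int a + int k"]
    by (simp add: closed_U_def choose_2_Suc algebra_simps)
qed

lemma closed_D_axis:
  "closed_D a a (r - 1) = qvar ^ (r choose 2) * qbinomial (2 * int a - 1) (int a - int r)"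
proof (cases r)
  case 0
  then show ?thesis
    by (simp add: closed_D_def numeral_2_eq_2)
next
  case (Suc k)
  then show ?thesis
    using qbinomial_sym[of "2 * int a - 1" "int a + int k"]
    by (simp add: closed_D_def choose_2_Suc algebra_simps)
qed

lemma qvar_power_powi: "int m + i = int n \<Longrightarrow> qvar ^ m * qvar powi i = qvar ^ n"
  using power_int_add[of qvar "int m" i] qvar_nonzero by simp

lemma closed_U_rec:
  assumes "a + b > 0"
  shows "closed_U (Suc a) b r =
    closed_U a b (if a = b then r - 1 else r) + qvar ^ (a + b) * closed_D a b r"
proof (cases "a < b")
  case True
  let ?n = "int a + int b" and ?k = "int a - int r"
  have "qvar ^ ((r choose 2) + b + r) * qvar powi ?k = qvar ^ (a + b) * qvar ^ (r choose 2)"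
    unfolding power_add[symmetric] by (rule qvar_power_powi) simp
  then have "qvar ^ ((r choose 2) + b + r) * qbinomial ?n ?k =
      qvar ^ ((r choose 2) + b + r) * qbinomial (?n - 1) (?k - 1) +
      qvar ^ (a + b) * qvar ^ (r choose 2) * qbinomial (?n - 1) ?k"
    using assms by (subst qbinomial_pascal) (auto simp: distrib_left simp flip: mult.assoc)
  then show ?thesis
    using True by (simp add: closed_U_def closed_D_def mult.assoc)
next
  case False
  let ?n = "int a + int b" and ?k = "int a + int r"
  have U: "closed_U a b (if a = b then r - 1 else r) =
      qvar ^ ((r choose 2) + b) * qbinomial (?n - 1) (?k - 1)"
    using False closed_U_axis[of a r] by (auto simp: closed_U_def)
  have "qvar ^ ((r choose 2) + b) * qvar powi ?k = qvar ^ (a + b) * qvar ^ ((r choose 2) + r)"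
    unfolding power_add[symmetric] by (rule qvar_power_powi) simp
  then have "qvar ^ ((r choose 2) + b) * qbinomial ?n ?k =
      qvar ^ ((r choose 2) + b) * qbinomial (?n - 1) (?k - 1) +
      qvar ^ (a + b) * qvar ^ ((r choose 2) + r) * qbinomial (?n - 1) ?k"
    using assms by (subst qbinomial_pascal) (auto simp: distrib_left simp flip: mult.assoc)
  then show ?thesis
    unfolding U using False by (simp add: closed_U_def closed_D_def mult.assoc)
qed

text \<open>
  These two instances of the second Pascal rule serve both for the recursion of \<open>closed_D\<close> and
  for the sum of the two closed forms.
\<close>

lemma pascal_above_axis:
  assumes "a + b > 0"
  shows "qvar ^ ((r choose 2) + b) * qbinomial (int a + int b - 1) (int a + int r - 1) +
      qvar ^ ((r choose 2) + r) * qbinomial (int a + int b - 1) (int a + int r) =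
    qvar ^ ((r choose 2) + r) * qbinomial (int a + int b) (int a + int r)"
proof -
  have "qvar ^ ((r choose 2) + r) * qvar powi (int a + int b - (int a + int r)) =
      qvar ^ ((r choose 2) + b)"
    by (rule qvar_power_powi) simp
  then show ?thesis
    using assms by (subst (3) qbinomial_pascal') (auto simp: distrib_left simp flip: mult.assoc)
qed

lemma pascal_below_axis:
  assumes "a + b > 0"
  shows "qvar ^ ((r choose 2) + b + r) * qbinomial (int a + int b - 1) (int a - int r - 1) +
      qvar ^ (r choose 2) * qbinomial (int a + int b - 1) (int a - int r) =
    qvar ^ (r choose 2) * qbinomial (int a + int b) (int a - int r)"
proof -
  have "qvar ^ (r choose 2) * qvar powi (int a + int b - (int a - int r)) =
      qvar ^ ((r choose 2) + b + r)"
    by (rule qvar_power_powi) simp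
  then show ?thesis
    using assms by (subst (3) qbinomial_pascal') (auto simp: distrib_left simp flip: mult.assoc)
qed

lemma closed_D_rec:
  assumes "a + b > 0"
  shows "closed_D a (Suc b) r = closed_U a b r + closed_D a b (if a = b then r - 1 else r)"
proof (cases "a > b")
  case True
  then show ?thesis
    using pascal_above_axis[OF assms, of r] by (simp add: closed_U_def closed_D_def)
next
  case False
  have D: "closed_D a b (if a = b then r - 1 else r) =
      qvar ^ (r choose 2) * qbinomial (int a + int b - 1) (int a - int r)"
    using False closed_D_axis[of a r] by (auto simp: closed_D_def)
  show ?thesis
    unfolding D using False pascal_below_axis[OF assms, of r]
    by (simp add: closed_U_def closed_D_def)
qed

lemma closed_no_step:
  "closed_U 0 b r = 0" "a > 0 \<Longrightarrow> closed_D a 0 r = 0"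
  by (simp_all add: closed_U_def closed_D_def qbinomial_def)

lemma closed_single_step:
  "closed_U 1 0 r = (if r = 0 then 1 else 0)"
  "closed_D 0 1 r = (if r = 0 then 1 else 0)"
  by (simp_all add: closed_U_def closed_D_def qbinomial_def numeral_2_eq_2)

text \<open>
  The induction starts at the paths with one step, because the recursion fails at the empty
  path, which has no last step.
\<close>

lemma ending_gf_closed:
  assumes "a + b > 0"
  shows "ending_gf U a b r = closed_U a b r \<and> ending_gf D a b r = closed_D a b r"
  using assms
proof (induction "a + b" arbitrary: a b r rule: less_induct)
  case less
  have "ending_gf U a b r = closed_U a b r"
  proof (cases a)
    case 0
    then show ?thesis
      by (simp add: ending_gf_no_step closed_no_step)
  next
    case (Suc a')
    show ?thesis
    proof (cases "a' + b = 0")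
      case True
      then show ?thesis
        using Suc ending_gf_single_step closed_single_step by simp
    next
      case False
      then show ?thesis
        using Suc less.hyps[of a' b] by (simp add: ending_gf_U_rec closed_U_rec)
    qed
  qed
  moreover have "ending_gf D a b r = closed_D a b r"
  proof (cases b)
    case 0
    then show ?thesis
      using less.prems by (simp add: ending_gf_no_step closed_no_step)
  next
    case (Suc b')
    show ?thesis
    proof (cases "a + b' = 0")
      case True
      then show ?thesis
        using Suc ending_gf_single_step closed_single_step by simp
    next
      case False
      then show ?thesis
        using Suc less.hyps[of a b'] by (simp add: ending_gf_D_rec closed_D_rec)
    qed
  qed
  ultimately show ?case
    by blast
qed

theorem theorem2p1:
  fixes a b r :: nat
  assumes "(a, b, r) \<noteq> (0, 0, 0)"
  shows "to_fract (crossing_gf a b r 0) =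
    (if a > b then
       qvar ^ ((r + 1) choose 2) * qbinomial (int a + int b) (int a + int r)
     else if a = b then
       (1 + qvar ^ a) * qvar ^ ((r + 1) choose 2) * qbinomial (2 * int a - 1) (int a + int r)
     else
       qvar ^ (r choose 2) * qbinomial (int a + int b) (int a - int r))"
proof (cases "a + b = 0")
  case True
  \<comment> \<open>The empty path has no crossings, and \<open>r > 0\<close>.\<close>
  have "P = []" if "P \<in> lattice_paths 0 0" for P
    using length_lattice_path[OF that] by simp
  moreover have "crossings 0 [] = {}"
    by (simp add: crossings_def)
  ultimately have "crossing_paths 0 0 r 0 = {}"
    using True assms by (fastforce simp: crossing_paths_def)
  then show ?thesis
    using True by (simp add: crossing_gf_def qbinomial_def)
next
  case False
  then have gf: "to_fract (crossing_gf a b r 0) = closed_U a b r + closed_D a b r"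
    by (simp add: to_fract_crossing_gf ending_gf_closed)
  consider "a > b" | "a = b" | "a < b"
    by linarith
  then show ?thesis
  proof cases
    case 1
    then show ?thesis
      using False pascal_above_axis[of a b r]
      by (simp add: gf closed_U_def closed_D_def choose_2_Suc)
  next
    case 2
    then show ?thesis
      using gf qbinomial_sym[of "2 * int a - 1" "int a + int r"]
      by (simp add: closed_U_def closed_D_def choose_2_Suc power_add algebra_simps)
  next
    case 3
    then show ?thesis
      using False pascal_below_axis[of a b r]
      by (simp add: gf closed_U_def closed_D_def)
  qed
qed

end
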